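(* Let $G$ be a finite triangle-free graph with a vertex ordering $v_1, v_2,\dots , v_n$. For each $i$, let $N_L(v_i)$ denote the set of neighbors $v_j$ of $v_i$ with $j<i$. Suppose $p:V(G)\rightarrow [0, 1]$ satisfies $$ p(v_i) \leq \prod_{v_j \in N_L(v_i)} \left(1-p(v_j)\right)$$ for all vertices $v_i$. Then there exists a probability distribution $\mathcal{I}$ over the independent sets of $G$ such that $$\mathbb{P}_{I\sim \mathcal{I}}(v_i\in I)\geq \alpha \cdot p(v_i)$$ for all vertices $v_i$, where $\alpha:=\frac{1-e^{-\frac12}}{2}$.
   Context: Graphs are finite and simple. An empty product equals $1$. *)

theory Defs
  imports "HOL-Probability.Probability" "Graph_Theory.Pair_Digraph"
begin

text \<open>
  A finite simple graph is a \<^locale>\<open>pair_graph\<close>: the vertex set is finite, and the set of arcs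
  is a symmetric, irreflexive relation on it, an edge \<open>uv\<close> being the two arcs \<open>(u, v)\<close> and \<open>(v, u)\<close>.
  The graph without vertices is included.
\<close>

text \<open>The three vertices of a triangle are automatically distinct, as there are no loops.\<close>

definition triangle_free :: "'a pair_pre_digraph \<Rightarrow> bool" where
  "triangle_free G \<longleftrightarrow>
     \<not> (\<exists>u v w. (u, v) \<in> parcs G \<and> (v, w) \<in> parcs G \<and> (u, w) \<in> parcs G)"

definition independent_set :: "'a pair_pre_digraph \<Rightarrow> 'a set \<Rightarrow> bool" where
  "independent_set G S \<longleftrightarrow> S \<subseteq> pverts G \<and> (\<forall>u\<in>S. \<forall>v\<in>S. (u, v) \<notin> parcs G)"

definition vertex_ordering :: "'a pair_pre_digraph \<Rightarrow> 'a list \<Rightarrow> bool" where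
  "vertex_ordering G vs \<longleftrightarrow> distinct vs \<and> set vs = pverts G"

text \<open>
  Positions in the list are counted from \<open>0\<close>, so \<open>vs ! i\<close> is the vertex usually written
  \<open>v\<close> with index \<open>i + 1\<close>.
\<close>

definition left_neighbors :: "'a pair_pre_digraph \<Rightarrow> 'a list \<Rightarrow> nat \<Rightarrow> 'a set" where
  "left_neighbors G vs i = {vs ! j | j. j < i \<and> (vs ! j, vs ! i) \<in> parcs G}"

end

theory Submission
  imports Defs
begin

text \<open>
  The random independent set is built by visiting the vertices in the given order. The vertex
  \<open>i\<close> carries the weight \<open>w i S = p i / 2 * (\<Prod>j\<in>N i. indicator (j \<notin> S) * exp (w j S))\<close>, where
  \<open>N i\<close> is its left neighbourhood and \<open>S\<close> the set selected so far, and it is selected with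
  probability \<open>1 - exp (- w i S)\<close>. The weight of \<open>i\<close> is killed as soon as a left neighbour is
  selected, so the result is independent; the factor \<open>exp (w j S)\<close> gained when \<open>j\<close> is not
  selected is the inverse of the probability of that event, so the weight evolves as a martingale
  with mean \<open>p i / 2\<close>.

  The selection probability falls short of the weight only where the weight is large, so one
  has to see that \<open>w i\<close> is rarely large, measured by its own mass. Reweighting the process by the
  density \<open>2 * w i / p i\<close> (for \<open>p i > 0\<close>) just yields the process in which the left neighbours of \<open>i\<close> are barred
  from selection (\<open>expectation_bar\<close>). If \<open>j\<close> is one of them, then no
  left neighbour of \<open>j\<close> is barred, because the graph is triangle-free; hence \<open>w j\<close> still has mean
  \<open>p j / 2\<close> in the reweighted process (\<open>expectation_weight\<close>). By Markov's inequality the event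
  \<open>(\<Sum>j\<in>N i. w j) \<le> (\<Sum>j\<in>N i. p j)\<close> has probability at least \<open>1 / 2\<close> there. On this event the
  hypothesis on \<open>p\<close> gives \<open>w i \<le> p i / 2 * exp (\<Sum>j\<in>N i. p j) \<le> 1 / 2\<close>, and by concavity the
  selection probability is then at least \<open>2 * (1 - exp (- 1 / 2))\<close> times the weight. Altogether \<open>i\<close>
  is selected with probability at least \<open>p i / 2 * (1 / 2) * (2 * (1 - exp (- 1 / 2)))\<close>.
\<close>

section \<open>The selection process\<close>

lemma one_minus_exp_ge_linear:
  fixes w :: real
  assumes "0 \<le> w" "w \<le> 1 / 2"
  shows "2 * w * (1 - exp (- (1 / 2))) \<le> 1 - exp (- w)"
proof -
  have "exp ((1 - 2 * w) *\<^sub>R 0 + (2 * w) *\<^sub>R (- (1 / 2)))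
      \<le> (1 - 2 * w) * exp 0 + 2 * w * exp (- (1 / 2) :: real)"
    by (rule convex_onD[OF exp_convex]) (use assms in auto)
  then show ?thesis by (simp add: algebra_simps)
qed

text \<open>
  Vertices are represented by their positions in the ordering, and \<open>N i\<close> is the left
  neighbourhood of \<open>i\<close>; triangle-freeness enters only as \<open>N_disjoint\<close>.
\<close>

locale ordered_triangle_free =
  fixes p :: "nat \<Rightarrow> real" and N :: "nat \<Rightarrow> nat set"
  assumes p_nonneg: "0 \<le> p i"
    and p_le_1: "p i \<le> 1"
    and p_le_prod: "p i \<le> (\<Prod>j\<in>N i. 1 - p j)"
    and N_left: "N i \<subseteq> {..<i}"
    and N_disjoint: "j \<in> N i \<Longrightarrow> N j \<inter> N i = {}"
begin

lemma finite_N: "finite (N i)"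
  using N_left finite_subset by blast

lemma N_less: "j \<in> N i \<Longrightarrow> j < i"
  using N_left by blast

text \<open>The intersection with \<open>{..<i}\<close> does not change \<open>N i\<close>; it makes the recursion terminate.\<close>

function weight :: "nat \<Rightarrow> nat set \<Rightarrow> real" where
  "weight i S =
     (if N i \<inter> S = {} then p i / 2 * exp (\<Sum>j\<in>N i \<inter> {..<i}. weight j S) else 0)"
  by auto
termination by (relation "Wellfounded.measure fst") auto

declare weight.simps [simp del]

lemma weight_eq: "weight i S = (if N i \<inter> S = {} then p i / 2 * exp (\<Sum>j\<in>N i. weight j S) else 0)"
  using N_left[of i] by (subst weight.simps) (simp add: Int_absorb2)

lemma weight_nonneg: "0 \<le> weight i S"
  by (simp add: weight_eq p_nonneg)

lemma weight_insert: "i \<le> n \<Longrightarrow> weight i (insert n S) = weight i S"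
proof (induction i rule: less_induct)
  case (less i)
  have "n \<notin> N i" using N_less less.prems by fastforce
  moreover have "(\<Sum>j\<in>N i. weight j (insert n S)) = (\<Sum>j\<in>N i. weight j S)"
    by (rule sum.cong) (use N_less less in \<open>auto intro: less.IH\<close>)
  ultimately show ?case by (simp add: weight_eq[of i])
qed

text \<open>
  The vertices in \<open>T\<close> are barred: they are never selected, while the weights are
  computed as before. The process of interest is the one with \<open>T = {}\<close>.
\<close>

definition select_prob :: "nat set \<Rightarrow> nat \<Rightarrow> nat set \<Rightarrow> real" where
  "select_prob T n S = (if n \<in> T then 0 else 1 - exp (- weight n S))"

fun selection :: "nat set \<Rightarrow> nat \<Rightarrow> nat set pmf" where
  "selection T 0 = return_pmf {}"
| "selection T (Suc n) = bind_pmf (selection T n) (\<lambda>S.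
     map_pmf (\<lambda>b. if b then insert n S else S) (bernoulli_pmf (select_prob T n S)))"

abbreviation expect :: "nat set \<Rightarrow> nat \<Rightarrow> (nat set \<Rightarrow> real) \<Rightarrow> real" where
  "expect T n \<equiv> measure_pmf.expectation (selection T n)"

lemma select_prob_bounds: "0 \<le> select_prob T n S" "select_prob T n S \<le> 1"
  by (auto simp: select_prob_def weight_nonneg)

lemma selection_subset: "S \<in> set_pmf (selection T n) \<Longrightarrow> S \<subseteq> {..<n}"
  by (induction n arbitrary: S) (auto split: if_splits, (force dest: less_SucI)+)

lemma finite_selection: "finite (set_pmf (selection T n))"
  by (rule finite_subset[of _ "Pow {..<n}"]) (use selection_subset in auto)

lemma integrable_selection: "integrable (measure_pmf (selection T n)) (f :: nat set \<Rightarrow> real)"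
  by (rule integrable_measure_pmf_finite[OF finite_selection])

lemma expect_mono:
  assumes "\<And>S. S \<in> set_pmf (selection T n) \<Longrightarrow> f S \<le> g S"
  shows "expect T n f \<le> expect T n g"
  by (rule integral_mono_AE) (use assms in \<open>auto simp: AE_measure_pmf_iff integrable_selection\<close>)

lemma expect_cong:
  assumes "\<And>S. S \<in> set_pmf (selection T n) \<Longrightarrow> f S = g S"
  shows "expect T n f = expect T n g"
  by (rule integral_cong_AE) (use assms in \<open>auto simp: AE_measure_pmf_iff\<close>)

lemma expect_Suc:
  "expect T (Suc n) f =
     expect T n (\<lambda>S. (1 - select_prob T n S) * f S + select_prob T n S * f (insert n S))"
  (is "_ = expect T n ?g")
proof -
  have "expect T (Suc n) f = (\<Sum>S\<in>Pow {..<n}. pmf (selection T n) S *\<^sub>R ?g S)"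
    unfolding selection.simps
    by (subst pmf_expectation_bind[where A = "Pow {..<n}"])
       (use selection_subset in \<open>auto simp: select_prob_bounds mult.commute add.commute intro!: sum.cong\<close>)
  also have "\<dots> = expect T n ?g"
    by (rule integral_measure_pmf[symmetric]) (use selection_subset in auto)
  finally show ?thesis .
qed

section \<open>Barring vertices as a change of measure\<close>

text \<open>
  The likelihood ratio of the process with \<open>A\<close> barred against the original one, once all
  vertices of \<open>A\<close> have been visited: each \<open>j \<in> A\<close> must be unselected, an event of conditional
  probability \<open>exp (- weight j S)\<close>.
\<close>

definition bar_density :: "nat set \<Rightarrow> nat set \<Rightarrow> real" where
  "bar_density A S = (if A \<inter> S = {} then exp (\<Sum>j\<in>A. weight j S) else 0)"

lemma weight_eq_bar_density: "weight i S = p i / 2 * bar_density (N i) S"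
  by (simp add: weight_eq[of i] bar_density_def)

lemma bar_density_insert: "A \<subseteq> {..<n} \<Longrightarrow> bar_density A (insert n S) = bar_density A S"
  by (auto simp: bar_density_def weight_insert less_imp_le subset_eq intro!: sum.cong)

text \<open>
  Step \<open>n\<close> multiplies the density by \<open>exp (weight n S)\<close> if \<open>n \<in> A\<close> is not selected, which cancels
  the probability \<open>exp (- weight n S)\<close> of this event, and by \<open>0\<close> if it is; a step \<open>n \<notin> A\<close> is the
  same in both processes. Here \<open>T\<close> and \<open>A\<close> are disjoint because a vertex that is already barred
  would still contribute its factor to the density.
\<close>

lemma expectation_bar_upto:
  assumes "T \<inter> A = {}"
  shows "expect T n (\<lambda>S. bar_density (A \<inter> {..<n}) S * f S) = expect (T \<union> A) n f"
proof (induction n arbitrary: f)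
  case 0
  then show ?case by (simp add: bar_density_def)
next
  case (Suc n)
  let ?D = "\<lambda>n. bar_density (A \<inter> {..<n})"
  have D_insert: "?D n (insert n S) = ?D n S" for S
    by (simp add: bar_density_insert)
  show ?case
  proof (cases "n \<in> A")
    case True
    then have "n \<notin> T" using assms by auto
    have A_Suc: "A \<inter> {..<Suc n} = insert n (A \<inter> {..<n})"
      using True by auto
    have "expect T (Suc n) (\<lambda>S. ?D (Suc n) S * f S) = expect T n (\<lambda>S. ?D n S * f S)"
      unfolding expect_Suc
    proof (rule expect_cong)
      fix S assume "S \<in> set_pmf (selection T n)"
      then have "n \<notin> S" using selection_subset by blast
      have "?D (Suc n) (insert n S) = 0"
        by (simp add: A_Suc bar_density_def)
      moreover have "?D (Suc n) S = exp (weight n S) * ?D n S"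
        using \<open>n \<notin> S\<close> by (simp add: A_Suc bar_density_def exp_add)
      moreover have "1 - select_prob T n S = exp (- weight n S)"
        using \<open>n \<notin> T\<close> by (simp add: select_prob_def)
      ultimately show "(1 - select_prob T n S) * (?D (Suc n) S * f S) +
          select_prob T n S * (?D (Suc n) (insert n S) * f (insert n S)) = ?D n S * f S"
        by (simp add: exp_minus)
    qed
    also have "\<dots> = expect (T \<union> A) n f" by (rule Suc.IH)
    also have "\<dots> = expect (T \<union> A) (Suc n) f"
      unfolding expect_Suc using True by (simp add: select_prob_def)
    finally show ?thesis .
  next
    case False
    have A_Suc: "A \<inter> {..<Suc n} = A \<inter> {..<n}"
      using False by (auto simp: less_Suc_eq)
    have "select_prob (T \<union> A) n = select_prob T n"
      using False by (auto simp: select_prob_def)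
    then have "expect (T \<union> A) (Suc n) f =
        expect (T \<union> A) n (\<lambda>S. (1 - select_prob T n S) * f S + select_prob T n S * f (insert n S))"
      by (simp only: expect_Suc)
    also have "\<dots> = expect T (Suc n) (\<lambda>S. ?D (Suc n) S * f S)"
      unfolding Suc.IH[symmetric] expect_Suc A_Suc D_insert by (simp add: algebra_simps)
    finally show ?thesis by simp
  qed
qed

lemma expectation_bar:
  assumes "T \<inter> A = {}" "A \<subseteq> {..<n}"
  shows "expect T n (\<lambda>S. bar_density A S * f S) = expect (T \<union> A) n f"
  using expectation_bar_upto[OF assms(1), of n f] assms(2) by (simp add: Int_absorb2)

text \<open>
  The weight of \<open>i\<close> is \<open>p i / 2\<close> times a probability density as long as none of its left
  neighbours is barred.
\<close>

lemma expectation_weight: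
  assumes "T \<inter> N i = {}" "i \<le> n"
  shows "expect T n (weight i) = p i / 2"
proof -
  have "expect T n (\<lambda>S. bar_density (N i) S * 1) = expect (T \<union> N i) n (\<lambda>S. 1)"
    by (rule expectation_bar) (use assms N_less in fastforce)+
  then show ?thesis
    unfolding weight_eq_bar_density by simp
qed

section \<open>Selection probabilities\<close>

text \<open>
  Barring the left neighbours of \<open>i\<close> leaves the mean \<open>p j / 2\<close> of their weights unchanged, so the
  sum of these weights has mean one half of the bound, and Markov's inequality applies. Its bound
  is void when the sum of the \<open>p j\<close> vanishes, but then all these weights vanish as well.
\<close>

lemma weight_sum_le_likely:
  "1 / 2 \<le> expect (N i) i (\<lambda>S. of_bool ((\<Sum>j\<in>N i. weight j S) \<le> (\<Sum>j\<in>N i. p j)))"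
    (is "_ \<le> expect _ _ (\<lambda>S. of_bool (?X S \<le> ?s))")
proof -
  have s_nonneg: "0 \<le> ?s" by (simp add: p_nonneg sum_nonneg)
  have X_nonneg: "0 \<le> ?X S" for S by (simp add: weight_nonneg sum_nonneg)
  have "expect (N i) i ?X = (\<Sum>j\<in>N i. expect (N i) i (weight j))"
    by (rule Bochner_Integration.integral_sum) (rule integrable_selection)
  also have "\<dots> = (\<Sum>j\<in>N i. p j / 2)"
    by (intro sum.cong refl expectation_weight) (use N_disjoint N_less in \<open>blast intro: less_imp_le\<close>)+
  finally have mean: "expect (N i) i ?X = ?s / 2" by (simp add: sum_divide_distrib)
  show ?thesis
  proof (cases "?s = 0")
    case True
    then have "p j = 0" if "j \<in> N i" for j
      using that by (simp add: sum_nonneg_eq_0_iff finite_N p_nonneg)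
    then have "?X S = 0" for S
      by (simp add: weight_eq_bar_density)
    with True show ?thesis by simp
  next
    case False
    with s_nonneg have "0 < ?s" by simp
    have "1 / 2 = expect (N i) i (\<lambda>S. 1 - ?X S / ?s)"
      using mean False by (simp add: integrable_selection)
    also have "\<dots> \<le> expect (N i) i (\<lambda>S. of_bool (?X S \<le> ?s))"
      by (rule expect_mono) (use \<open>0 < ?s\<close> X_nonneg in \<open>auto simp: field_simps\<close>)
    finally show ?thesis .
  qed
qed

text \<open>
  This caps \<open>weight i\<close> at \<open>1 / 2\<close> whenever the left neighbours have total weight at most the sum of
  their \<open>p j\<close>; it combines the hypothesis on \<open>p\<close> with \<open>1 - x \<le> exp (- x)\<close>.
\<close>

lemma p_mult_exp_le_1: "p i * exp (\<Sum>j\<in>N i. p j) \<le> 1"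
proof -
  have "p i \<le> (\<Prod>j\<in>N i. 1 - p j)" by (rule p_le_prod)
  also have "\<dots> \<le> (\<Prod>j\<in>N i. exp (- p j))"
    by (rule prod_mono) (use exp_ge_add_one_self[of "- p _"] p_le_1 in auto)
  also have "\<dots> = exp (- (\<Sum>j\<in>N i. p j))"
    by (simp add: exp_sum[OF finite_N] sum_negf[symmetric])
  finally show ?thesis by (simp add: exp_minus field_simps)
qed

text \<open>
  Pointwise, the selection probability is at least \<open>2 * (1 - exp (- 1 / 2))\<close> times the weight on the
  event of the Markov bound, and at least \<open>0\<close> off it. The weight is \<open>p i / 2\<close> times the density of
  barring \<open>N i\<close>, so taking means leaves the probability of that event in the barred process.
\<close>

lemma select_prob_expectation_ge:
  "(1 - exp (- (1 / 2))) / 2 * p i \<le> expect {} i (select_prob {} i)"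
proof -
  let ?c = "1 - exp (- (1 / 2)) :: real"
  let ?X = "\<lambda>S. \<Sum>j\<in>N i. weight j S" and ?s = "\<Sum>j\<in>N i. p j"
  have c_pos: "0 \<le> ?c * p i" by (simp add: p_nonneg)
  have "?c / 2 * p i = ?c * p i * (1 / 2)" by simp
  also have "\<dots> \<le> ?c * p i * expect (N i) i (\<lambda>S. of_bool (?X S \<le> ?s))"
    by (rule mult_left_mono[OF weight_sum_le_likely c_pos])
  also have "\<dots> = ?c * p i * expect {} i (\<lambda>S. bar_density (N i) S * of_bool (?X S \<le> ?s))"
    by (subst expectation_bar) (use N_left in auto)
  also have "\<dots> = expect {} i (\<lambda>S. ?c * p i * (bar_density (N i) S * of_bool (?X S \<le> ?s)))"
    by simp
  also have "\<dots> \<le> expect {} i (select_prob {} i)"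
  proof (rule expect_mono)
    fix S
    show "?c * p i * (bar_density (N i) S * of_bool (?X S \<le> ?s)) \<le> select_prob {} i S"
    proof (cases "?X S \<le> ?s")
      case True
      have "weight i S \<le> p i / 2 * exp ?s"
        using True by (auto simp: weight_eq[of i] p_nonneg intro!: mult_left_mono)
      also have "\<dots> \<le> 1 / 2" using p_mult_exp_le_1[of i] by simp
      finally have "2 * weight i S * ?c \<le> 1 - exp (- weight i S)"
        by (intro one_minus_exp_ge_linear weight_nonneg)
      then show ?thesis
        using True by (simp add: select_prob_def weight_eq_bar_density mult_ac)
    qed (simp add: select_prob_bounds)
  qed
  finally show ?thesis .
qed

lemma prob_mem_selection:
  assumes "i < n"
  shows "measure_pmf.prob (selection {} n) {S. i \<in> S} = expect {} i (select_prob {} i)"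
proof -
  have "expect {} n (indicator {S. i \<in> S}) = expect {} i (select_prob {} i)"
    using assms
  proof (induction n)
    case (Suc n)
    show ?case
    proof (cases "i = n")
      case True
      have "i \<notin> S" if "S \<in> set_pmf (selection {} i)" for S
        using selection_subset that by blast
      then show ?thesis
        unfolding expect_Suc True[symmetric] by (intro expect_cong) (simp add: indicator_def)
    next
      case False
      then have "expect {} (Suc n) (indicator {S. i \<in> S}) = expect {} n (indicator {S. i \<in> S})"
        unfolding expect_Suc by (intro expect_cong) (simp add: indicator_def)
      with Suc False show ?thesis by simp
    qed
  qed simp
  then show ?thesis by simp
qed

lemma selection_independent:
  assumes "S \<in> set_pmf (selection {} n)" "i \<in> S"
  shows "N i \<inter> S = {}"
  using assms
proof (induction n arbitrary: S i)
  case (Suc n)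
  from Suc.prems(1) obtain S' b where S': "S' \<in> set_pmf (selection {} n)"
    and b: "b \<in> set_pmf (bernoulli_pmf (select_prob {} n S'))"
    and S: "S = (if b then insert n S' else S')"
    by auto
  have S'_less: "j < n" if "j \<in> S'" for j
    using selection_subset[OF S'] that by auto
  show ?case
  proof (cases b)
    case True
    with b have "select_prob {} n S' \<noteq> 0"
      by (auto simp: set_pmf_iff)
    then have "N n \<inter> S' = {}"
      by (auto simp: select_prob_def weight_eq[of n] split: if_splits)
    then have "N n \<inter> S = {}" using S True N_less by auto
    moreover have "N i \<inter> S = {}" if "i \<in> S'"
      using Suc.IH[OF S' that] N_less[of n i] S'_less[OF that] S by auto
    ultimately show ?thesis using Suc.prems(2) S True by auto
  next
    case False
    with S S' Suc show ?thesis by auto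
  qed
qed simp

end

section \<open>The independent set of a graph\<close>

theorem theorem1p3:
  fixes G :: "'a pair_pre_digraph" and vs :: "'a list" and p :: "'a \<Rightarrow> real"
  assumes "pair_graph G"
    and "triangle_free G"
    and "vertex_ordering G vs"
    and "\<And>v. v \<in> pverts G \<Longrightarrow> 0 \<le> p v \<and> p v \<le> 1"
    and "\<And>i. i < length vs \<Longrightarrow> p (vs ! i) \<le> (\<Prod>u\<in>left_neighbors G vs i. 1 - p u)"
  shows "\<exists>\<I> :: 'a set pmf.
           (\<forall>I\<in>set_pmf \<I>. independent_set G I) \<and>
           (\<forall>v\<in>pverts G. measure_pmf.prob \<I> {I. v \<in> I} \<ge> (1 - exp (- (1 / 2))) / 2 * p v)"
proof -
  interpret pair_graph G by fact
  have vs: "distinct vs" "set vs = pverts G"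
    using assms(3) by (auto simp: vertex_ordering_def)
  \<comment> \<open>Positions outside the list become isolated vertices with \<open>p = 0\<close>.\<close>
  define q where "q i = (if i < length vs then p (vs ! i) else 0)" for i
  define N where "N i = {j. j < i \<and> i < length vs \<and> (vs ! j, vs ! i) \<in> parcs G}" for i
  have arc_sym: "(v, u) \<in> parcs G" if "(u, v) \<in> parcs G" for u v
    using that by (rule arcs_symmetric)
  interpret ordered_triangle_free q N
  proof
    fix i j
    show "0 \<le> q i" "q i \<le> 1"
      using assms(4)[of "vs ! i"] nth_mem[of i vs] vs by (auto simp: q_def)
    show "N i \<subseteq> {..<i}" by (auto simp: N_def)
    show "N j \<inter> N i = {}" if "j \<in> N i"
      using that assms(2) by (auto simp: N_def triangle_free_def)
    show "q i \<le> (\<Prod>j\<in>N i. 1 - q j)"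
    proof (cases "i < length vs")
      case True
      have "inj_on ((!) vs) (N i)"
        by (rule inj_on_nth) (use vs in \<open>auto simp: N_def\<close>)
      moreover have "left_neighbors G vs i = (!) vs ` N i"
        using True by (auto simp: left_neighbors_def N_def)
      ultimately have "(\<Prod>u\<in>left_neighbors G vs i. 1 - p u) = (\<Prod>j\<in>N i. 1 - p (vs ! j))"
        by (simp add: prod.reindex)
      also have "\<dots> = (\<Prod>j\<in>N i. 1 - q j)"
        by (rule prod.cong) (auto simp: q_def N_def)
      finally show ?thesis using assms(5)[OF True] True by (simp add: q_def)
    qed (simp add: q_def N_def)
  qed
  let ?n = "length vs"
  define \<I> where "\<I> = map_pmf (\<lambda>S. (!) vs ` S) (selection {} ?n)"
  have "independent_set G I" if "I \<in> set_pmf \<I>" for I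
  proof -
    from that obtain S where S: "S \<in> set_pmf (selection {} ?n)" and I: "I = (!) vs ` S"
      by (auto simp: \<I>_def)
    have less: "i < ?n" if "i \<in> S" for i
      using selection_subset[OF S] that by auto
    have "(vs ! i, vs ! j) \<notin> parcs G" if "i \<in> S" "j \<in> S" for i j
    proof
      assume arc: "(vs ! i, vs ! j) \<in> parcs G"
      then have "i \<noteq> j" using no_loops'[OF arc] by auto
      then have "i \<in> N j \<or> j \<in> N i"
        using arc arc_sym[OF arc] less[OF that(1)] less[OF that(2)]
        unfolding N_def by (cases i j rule: linorder_cases) simp_all
      then show False
        using selection_independent[OF S that(1)] selection_independent[OF S that(2)] that by blast
    qed
    then show ?thesis
      using less vs(2) nth_mem[of _ vs] unfolding independent_set_def I by blast
  qed
  moreover have "(1 - exp (- (1 / 2))) / 2 * p v \<le> measure_pmf.prob \<I> {I. v \<in> I}"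
    if v: "v \<in> pverts G" for v
  proof -
    obtain i where i: "i < ?n" "v = vs ! i"
      using v vs(2) by (metis in_set_conv_nth)
    have "(1 - exp (- (1 / 2))) / 2 * p v \<le> expect {} i (select_prob {} i)"
      using select_prob_expectation_ge[of i] i by (simp add: q_def)
    also have "\<dots> = measure_pmf.prob (selection {} ?n) {S. i \<in> S}"
      by (rule prob_mem_selection[OF i(1), symmetric])
    also have "\<dots> \<le> measure_pmf.prob (selection {} ?n) ((\<lambda>S. (!) vs ` S) -` {I. v \<in> I})"
      by (rule measure_pmf.finite_measure_mono) (use i in auto)
    also have "\<dots> = measure_pmf.prob \<I> {I. v \<in> I}"
      by (simp add: \<I>_def measure_map_pmf)
    finally show ?thesis .
  qed
  ultimately show ?thesis by blast
qed

end
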